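(* Let $G$ be a group. Every monoidal $G$-category is equivalent to a strict monoidal $G$-category. That is, for every monoidal $G$-category $\mathcal{C}$ there exists a strict monoidal $G$-category $\mathcal{D}$ such that $\mathcal{C}$ and $\mathcal{D}$ are equivalent as monoidal $G$-categories.
   Context: Convention: "monoidal category" means strict monoidal category (associativity and unit constraints are identities); the unit object is denoted $\mathbf{1}$. A monoidal functor $(F,F_2,F_0):\mathcal{C}\to\mathcal{D}$ consists of a functor $F$, natural isomorphisms $F_2(X,Y):F(X\otimes Y)\to F(X)\otimes F(Y)$ and an isomorphism $F_0:F(\mathbf{1})\to\mathbf{1}$ satisfying $(F_2(X,Y)\otimes \mathrm{id}_{F(Z)})F_2(X\otimes Y,Z)=(\mathrm{id}_{F(X)}\otimes F_2(Y,Z))F_2(X,Y\otimes Z)$ and $(\mathrm{id}_{F(X)}\otimes F_0)F_2(X,\mathbf{1})=\mathrm{id}_{F(X)}=(F_0\otimes \mathrm{id}_{F(X)})F_2(\mathbf{1},X)$. Monoidal natural transformations are natural transformations compatible with $F_2$ and $F_0$. The composite $GF$ of monoidal functors has $(GF)_2(X,Y)=G_2(F(X),F(Y))\,G(F_2(X,Y))$ and $(GF)_0=G_0\,G(F_0)$. A monoidal $G$-category is a monoidal category $\mathcal{C}$ together with: functors $g_*:\mathcal{C}\to\mathcal{C}$ for $g\in G$; natural isomorphisms $\phi(g,h):(gh)_*\to g_*\circ h_*$ for $g,h\in G$; natural isomorphisms $\psi^g(X,Y):g_*(X\otimes Y)\to g_*(X)\otimes g_*(Y)$ for $g\in G$;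 such that $g_*(\mathbf{1})=\mathbf{1}$, $\psi^g(X,\mathbf{1})=\psi^g(\mathbf{1},X)=\mathrm{id}_{g_*(X)}$, $e_*=\mathrm{Id}_{\mathcal{C}}$, $\phi(e,g)=\phi(g,e)=\mathrm{Id}_{g_*}$, and for all $g,h,k\in G$ and objects $X,Y,Z$: - $\phi(g,h)_{k_*(X)}\circ\phi(gh,k)_X=g_*(\phi(h,k)_X)\circ\phi(g,hk)_X$; - $(\psi^g(X,Y)\otimes \mathrm{id}_{g_*(Z)})\circ\psi^g(X\otimes Y,Z)=(\mathrm{id}_{g_*(X)}\otimes\psi^g(Y,Z))\circ\psi^g(X,Y\otimes Z)$; - $(\phi(g,h)_X\otimes\phi(g,h)_Y)\circ\psi^{gh}(X,Y)=\psi^g(h_*(X),h_*(Y))\circ g_*(\psi^h(X,Y))\circ\phi(g,h)_{X\otimes Y}$. It is strict if all $\psi^g$ and all $\phi(g,h)$ are identities. A monoidal $G$-functor $(F,\eta):\mathcal{C}\to\mathcal{D}$ between monoidal $G$-categories is a monoidal functor $F$ with monoidal natural isomorphisms $\eta(g):g_*\circ F\to F\circ g_*$ ($g\in G$) such that $\eta(e)=\mathrm{Id}_F$ and $F(\phi(g,h)_X)\circ\eta(gh)_X=\eta(g)_{h_*(X)}\circ g_*(\eta(h)_X)\circ\phi(g,h)_{F(X)}$ for all $g,h\in G$ and all objects $X$. It is an equivalence of monoidal $G$-categories if $F$ is an equivalence of categories; $\mathcal{C}$ and $\mathcal{D}$ are equivalent if such an equivalence between them exists. *)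

theory Defs
  imports "HOL-Algebra.Group"
begin

section \<open>Categories, functors and natural isomorphisms\<close>

text \<open>Categories are records carrying a set of objects and a set of arrows; the record
  fields are only meaningful on these carriers, so all laws are relativised to them.\<close>

record ('o, 'm) category =
  Obj :: "'o set"
  Arr :: "'m set"
  Dom :: "'m \<Rightarrow> 'o"
  Cod :: "'m \<Rightarrow> 'o"
  Ide :: "'o \<Rightarrow> 'm"
  Comp :: "'m \<Rightarrow> 'm \<Rightarrow> 'm"  (infixr \<open>\<cdot>\<index>\<close> 60)

definition Hom :: "('o, 'm, 'z) category_scheme \<Rightarrow> 'o \<Rightarrow> 'o \<Rightarrow> 'm set" where
  "Hom C X Y = {f \<in> Arr C. Dom C f = X \<and> Cod C f = Y}"

locale category =
  fixes C :: "('o, 'm, 'z) category_scheme" (structure)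
  assumes Dom_in_Obj: "f \<in> Arr C \<Longrightarrow> Dom C f \<in> Obj C"
    and Cod_in_Obj: "f \<in> Arr C \<Longrightarrow> Cod C f \<in> Obj C"
    and Ide_in_Hom: "X \<in> Obj C \<Longrightarrow> Ide C X \<in> Hom C X X"
    and Comp_in_Hom: "\<lbrakk>f \<in> Hom C X Y; g \<in> Hom C Y Z\<rbrakk> \<Longrightarrow> g \<cdot> f \<in> Hom C X Z"
    and Comp_assoc: "\<lbrakk>f \<in> Hom C W X; g \<in> Hom C X Y; h \<in> Hom C Y Z\<rbrakk>
          \<Longrightarrow> (h \<cdot> g) \<cdot> f = h \<cdot> (g \<cdot> f)"
    and Comp_Ide_right: "f \<in> Hom C X Y \<Longrightarrow> f \<cdot> Ide C X = f"
    and Comp_Ide_left: "f \<in> Hom C X Y \<Longrightarrow> Ide C Y \<cdot> f = f"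

definition Iso :: "('o, 'm, 'z) category_scheme \<Rightarrow> 'o \<Rightarrow> 'o \<Rightarrow> 'm set" where
  "Iso C X Y = {f \<in> Hom C X Y. \<exists>g \<in> Hom C Y X. g \<cdot>\<^bsub>C\<^esub> f = Ide C X \<and> f \<cdot>\<^bsub>C\<^esub> g = Ide C Y}"

record ('o, 'm, 'p, 'n) cat_functor =
  FObj :: "'o \<Rightarrow> 'p"
  FArr :: "'m \<Rightarrow> 'n"

locale cat_functor = C: category C + D: category D
  for C :: "('o, 'm, 'y) category_scheme"
    and D :: "('p, 'n, 'z) category_scheme" +
  fixes F :: "('o, 'm, 'p, 'n, 'w) cat_functor_scheme"
  assumes FObj_in_Obj: "X \<in> Obj C \<Longrightarrow> FObj F X \<in> Obj D"
    and FArr_in_Hom: "f \<in> Hom C X Y \<Longrightarrow> FArr F f \<in> Hom D (FObj F X) (FObj F Y)"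
    and FArr_Ide: "X \<in> Obj C \<Longrightarrow> FArr F (Ide C X) = Ide D (FObj F X)"
    and FArr_Comp: "\<lbrakk>f \<in> Hom C X Y; g \<in> Hom C Y Z\<rbrakk>
          \<Longrightarrow> FArr F (g \<cdot>\<^bsub>C\<^esub> f) = FArr F g \<cdot>\<^bsub>D\<^esub> FArr F f"

definition id_functor :: "('o, 'm, 'o, 'm) cat_functor" where
  "id_functor = \<lparr>FObj = (\<lambda>X. X), FArr = (\<lambda>f. f)\<rparr>"

definition comp_functor ::
  "('p, 'n, 'q, 'l, 'y) cat_functor_scheme \<Rightarrow> ('o, 'm, 'p, 'n, 'z) cat_functor_scheme
     \<Rightarrow> ('o, 'm, 'q, 'l) cat_functor" where
  "comp_functor K F = \<lparr>FObj = FObj K \<circ> FObj F, FArr = FArr K \<circ> FArr F\<rparr>"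

definition nat_iso ::
  "('o, 'm, 'y) category_scheme \<Rightarrow> ('p, 'n, 'z) category_scheme
     \<Rightarrow> ('o, 'm, 'p, 'n, 'v) cat_functor_scheme \<Rightarrow> ('o, 'm, 'p, 'n, 'w) cat_functor_scheme
     \<Rightarrow> ('o \<Rightarrow> 'n) \<Rightarrow> bool" where
  "nat_iso C D F K \<alpha> \<longleftrightarrow>
     (\<forall>X \<in> Obj C. \<alpha> X \<in> Iso D (FObj F X) (FObj K X)) \<and>
     (\<forall>X \<in> Obj C. \<forall>Y \<in> Obj C. \<forall>f \<in> Hom C X Y.
        FArr K f \<cdot>\<^bsub>D\<^esub> \<alpha> X = \<alpha> Y \<cdot>\<^bsub>D\<^esub> FArr F f)"

definition equivalence_of_categories ::
  "('o, 'm, 'y) category_scheme \<Rightarrow> ('p, 'n, 'z) category_scheme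
     \<Rightarrow> ('o, 'm, 'p, 'n, 'w) cat_functor_scheme \<Rightarrow> bool" where
  "equivalence_of_categories C D F \<longleftrightarrow>
     cat_functor C D F \<and>
     (\<exists>(K :: ('p, 'n, 'o, 'm) cat_functor) \<alpha> \<beta>.
        cat_functor D C K \<and>
        nat_iso C C (comp_functor K F) id_functor \<alpha> \<and>
        nat_iso D D (comp_functor F K) id_functor \<beta>)"


section \<open>Strict monoidal categories and monoidal functors\<close>

record ('o, 'm) monoidal_category = "('o, 'm) category" +
  TensorObj :: "'o \<Rightarrow> 'o \<Rightarrow> 'o"  (infixr \<open>\<boxtimes>\<index>\<close> 70)
  TensorArr :: "'m \<Rightarrow> 'm \<Rightarrow> 'm"  (infixr \<open>\<odot>\<index>\<close> 70)
  Unit :: "'o"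

text \<open>Following the convention that a monoidal category is a strict one, associativity and
  unitality of the tensor product are equations, on objects and on arrows.\<close>

locale monoidal_category = category C
  for C :: "('o, 'm, 'z) monoidal_category_scheme" (structure) +
  assumes Tensor_in_Obj: "\<lbrakk>X \<in> Obj C; Y \<in> Obj C\<rbrakk> \<Longrightarrow> X \<boxtimes> Y \<in> Obj C"
    and Tensor_in_Hom: "\<lbrakk>f \<in> Hom C X X'; k \<in> Hom C Y Y'\<rbrakk>
          \<Longrightarrow> f \<odot> k \<in> Hom C (X \<boxtimes> Y) (X' \<boxtimes> Y')"
    and Tensor_Ide: "\<lbrakk>X \<in> Obj C; Y \<in> Obj C\<rbrakk>
          \<Longrightarrow> Ide C X \<odot> Ide C Y = Ide C (X \<boxtimes> Y)"
    and Tensor_Comp: "\<lbrakk>f \<in> Hom C X X'; f' \<in> Hom C X' X''; k \<in> Hom C Y Y'; k' \<in> Hom C Y' Y''\<rbrakk>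
          \<Longrightarrow> (f' \<cdot> f) \<odot> (k' \<cdot> k) = (f' \<odot> k') \<cdot> (f \<odot> k)"
    and Unit_in_Obj: "Unit C \<in> Obj C"
    and TensorObj_assoc: "\<lbrakk>X \<in> Obj C; Y \<in> Obj C; Z \<in> Obj C\<rbrakk>
          \<Longrightarrow> (X \<boxtimes> Y) \<boxtimes> Z = X \<boxtimes> (Y \<boxtimes> Z)"
    and TensorArr_assoc: "\<lbrakk>f \<in> Arr C; k \<in> Arr C; l \<in> Arr C\<rbrakk>
          \<Longrightarrow> (f \<odot> k) \<odot> l = f \<odot> (k \<odot> l)"
    and TensorObj_Unit_right: "X \<in> Obj C \<Longrightarrow> X \<boxtimes> Unit C = X"
    and TensorObj_Unit_left: "X \<in> Obj C \<Longrightarrow> Unit C \<boxtimes> X = X"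
    and TensorArr_Unit_right: "f \<in> Arr C \<Longrightarrow> f \<odot> Ide C (Unit C) = f"
    and TensorArr_Unit_left: "f \<in> Arr C \<Longrightarrow> Ide C (Unit C) \<odot> f = f"

text \<open>Naturality of isomorphisms \<open>t X Y : F (X \<otimes> Y) \<rightarrow> F X \<otimes> F Y\<close> in both variables.\<close>

definition tensor_nat_iso ::
  "('o, 'm, 'y) monoidal_category_scheme \<Rightarrow> ('p, 'n, 'z) monoidal_category_scheme
     \<Rightarrow> ('o, 'm, 'p, 'n, 'w) cat_functor_scheme \<Rightarrow> ('o \<Rightarrow> 'o \<Rightarrow> 'n) \<Rightarrow> bool" where
  "tensor_nat_iso C D F t \<longleftrightarrow>
     (\<forall>X \<in> Obj C. \<forall>Y \<in> Obj C.
        t X Y \<in> Iso D (FObj F (X \<boxtimes>\<^bsub>C\<^esub> Y)) (FObj F X \<boxtimes>\<^bsub>D\<^esub> FObj F Y)) \<and>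
     (\<forall>X \<in> Obj C. \<forall>X' \<in> Obj C. \<forall>Y \<in> Obj C. \<forall>Y' \<in> Obj C.
        \<forall>f \<in> Hom C X X'. \<forall>k \<in> Hom C Y Y'.
          (FArr F f \<odot>\<^bsub>D\<^esub> FArr F k) \<cdot>\<^bsub>D\<^esub> t X Y = t X' Y' \<cdot>\<^bsub>D\<^esub> FArr F (f \<odot>\<^bsub>C\<^esub> k))"

record ('o, 'm, 'p, 'n) monoidal_functor = "('o, 'm, 'p, 'n) cat_functor" +
  F2 :: "'o \<Rightarrow> 'o \<Rightarrow> 'n"
  F0 :: "'n"

locale monoidal_functor = cat_functor C D F + C: monoidal_category C + D: monoidal_category D
  for C :: "('o, 'm, 'y) monoidal_category_scheme"
    and D :: "('p, 'n, 'z) monoidal_category_scheme"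
    and F :: "('o, 'm, 'p, 'n, 'w) monoidal_functor_scheme" +
  assumes F2_nat_iso: "tensor_nat_iso C D F (F2 F)"
    and F0_iso: "F0 F \<in> Iso D (FObj F (Unit C)) (Unit D)"
    and F2_assoc: "\<lbrakk>X \<in> Obj C; Y \<in> Obj C; Z \<in> Obj C\<rbrakk> \<Longrightarrow>
          (F2 F X Y \<odot>\<^bsub>D\<^esub> Ide D (FObj F Z)) \<cdot>\<^bsub>D\<^esub> F2 F (X \<boxtimes>\<^bsub>C\<^esub> Y) Z
          = (Ide D (FObj F X) \<odot>\<^bsub>D\<^esub> F2 F Y Z) \<cdot>\<^bsub>D\<^esub> F2 F X (Y \<boxtimes>\<^bsub>C\<^esub> Z)"
    and F2_Unit_right: "X \<in> Obj C \<Longrightarrow>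
          (Ide D (FObj F X) \<odot>\<^bsub>D\<^esub> F0 F) \<cdot>\<^bsub>D\<^esub> F2 F X (Unit C) = Ide D (FObj F X)"
    and F2_Unit_left: "X \<in> Obj C \<Longrightarrow>
          (F0 F \<odot>\<^bsub>D\<^esub> Ide D (FObj F X)) \<cdot>\<^bsub>D\<^esub> F2 F (Unit C) X = Ide D (FObj F X)"

text \<open>The composite \<open>K F\<close> of monoidal functors; \<open>E\<close> is the target category of \<open>K\<close>.\<close>

definition comp_monoidal_functor ::
  "('q, 'l, 'x) category_scheme
     \<Rightarrow> ('p, 'n, 'q, 'l, 'y) monoidal_functor_scheme
     \<Rightarrow> ('o, 'm, 'p, 'n, 'z) monoidal_functor_scheme
     \<Rightarrow> ('o, 'm, 'q, 'l) monoidal_functor" where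
  "comp_monoidal_functor E K F =
     \<lparr>FObj = FObj K \<circ> FObj F, FArr = FArr K \<circ> FArr F,
      F2 = (\<lambda>X Y. F2 K (FObj F X) (FObj F Y) \<cdot>\<^bsub>E\<^esub> FArr K (F2 F X Y)),
      F0 = F0 K \<cdot>\<^bsub>E\<^esub> FArr K (F0 F)\<rparr>"

definition monoidal_nat_iso ::
  "('o, 'm, 'y) monoidal_category_scheme \<Rightarrow> ('p, 'n, 'z) monoidal_category_scheme
     \<Rightarrow> ('o, 'm, 'p, 'n, 'v) monoidal_functor_scheme
     \<Rightarrow> ('o, 'm, 'p, 'n, 'w) monoidal_functor_scheme \<Rightarrow> ('o \<Rightarrow> 'n) \<Rightarrow> bool" where
  "monoidal_nat_iso C D F K \<alpha> \<longleftrightarrow>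
     nat_iso C D F K \<alpha> \<and>
     (\<forall>X \<in> Obj C. \<forall>Y \<in> Obj C.
        (\<alpha> X \<odot>\<^bsub>D\<^esub> \<alpha> Y) \<cdot>\<^bsub>D\<^esub> F2 F X Y = F2 K X Y \<cdot>\<^bsub>D\<^esub> \<alpha> (X \<boxtimes>\<^bsub>C\<^esub> Y)) \<and>
     F0 K \<cdot>\<^bsub>D\<^esub> \<alpha> (Unit C) = F0 F"


section \<open>Monoidal \<open>G\<close>-categories\<close>

record ('g, 'o, 'm) monoidal_G_category = "('o, 'm) monoidal_category" +
  Act :: "'g \<Rightarrow> ('o, 'm, 'o, 'm) cat_functor"
  Phi :: "'g \<Rightarrow> 'g \<Rightarrow> 'o \<Rightarrow> 'm"
  Psi :: "'g \<Rightarrow> 'o \<Rightarrow> 'o \<Rightarrow> 'm"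

abbreviation ActObj :: "('g, 'o, 'm, 'z) monoidal_G_category_scheme \<Rightarrow> 'g \<Rightarrow> 'o \<Rightarrow> 'o" where
  "ActObj C g \<equiv> FObj (Act C g)"

abbreviation ActArr :: "('g, 'o, 'm, 'z) monoidal_G_category_scheme \<Rightarrow> 'g \<Rightarrow> 'm \<Rightarrow> 'm" where
  "ActArr C g \<equiv> FArr (Act C g)"

locale monoidal_G_category = G: group G + monoidal_category C
  for G :: "('g, 'y) monoid_scheme"
    and C :: "('g, 'o, 'm, 'z) monoidal_G_category_scheme" (structure) +
  assumes Act_functor: "g \<in> carrier G \<Longrightarrow> cat_functor C C (Act C g)"
    and Phi_nat_iso: "\<lbrakk>g \<in> carrier G; h \<in> carrier G\<rbrakk>
          \<Longrightarrow> nat_iso C C (Act C (g \<otimes>\<^bsub>G\<^esub> h)) (comp_functor (Act C g) (Act C h)) (Phi C g h)"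
    and Psi_nat_iso: "g \<in> carrier G \<Longrightarrow> tensor_nat_iso C C (Act C g) (Psi C g)"
    and Act_Unit: "g \<in> carrier G \<Longrightarrow> ActObj C g (Unit C) = Unit C"
    and Psi_Unit_right: "\<lbrakk>g \<in> carrier G; X \<in> Obj C\<rbrakk>
          \<Longrightarrow> Psi C g X (Unit C) = Ide C (ActObj C g X)"
    and Psi_Unit_left: "\<lbrakk>g \<in> carrier G; X \<in> Obj C\<rbrakk>
          \<Longrightarrow> Psi C g (Unit C) X = Ide C (ActObj C g X)"
    and ActObj_one: "X \<in> Obj C \<Longrightarrow> ActObj C \<one>\<^bsub>G\<^esub> X = X"
    and ActArr_one: "f \<in> Arr C \<Longrightarrow> ActArr C \<one>\<^bsub>G\<^esub> f = f"
    and Phi_one_left: "\<lbrakk>g \<in> carrier G; X \<in> Obj C\<rbrakk>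
          \<Longrightarrow> Phi C \<one>\<^bsub>G\<^esub> g X = Ide C (ActObj C g X)"
    and Phi_one_right: "\<lbrakk>g \<in> carrier G; X \<in> Obj C\<rbrakk>
          \<Longrightarrow> Phi C g \<one>\<^bsub>G\<^esub> X = Ide C (ActObj C g X)"
    and Phi_assoc:
      "\<lbrakk>g \<in> carrier G; h \<in> carrier G; k \<in> carrier G; X \<in> Obj C\<rbrakk> \<Longrightarrow>
         Phi C g h (ActObj C k X) \<cdot> Phi C (g \<otimes>\<^bsub>G\<^esub> h) k X
         = ActArr C g (Phi C h k X) \<cdot> Phi C g (h \<otimes>\<^bsub>G\<^esub> k) X"
    and Psi_assoc:
      "\<lbrakk>g \<in> carrier G; X \<in> Obj C; Y \<in> Obj C; Z \<in> Obj C\<rbrakk> \<Longrightarrow>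
         (Psi C g X Y \<odot> Ide C (ActObj C g Z)) \<cdot> Psi C g (X \<boxtimes> Y) Z
         = (Ide C (ActObj C g X) \<odot> Psi C g Y Z) \<cdot> Psi C g X (Y \<boxtimes> Z)"
    and Phi_Psi:
      "\<lbrakk>g \<in> carrier G; h \<in> carrier G; X \<in> Obj C; Y \<in> Obj C\<rbrakk> \<Longrightarrow>
         (Phi C g h X \<odot> Phi C g h Y) \<cdot> Psi C (g \<otimes>\<^bsub>G\<^esub> h) X Y
         = Psi C g (ActObj C h X) (ActObj C h Y) \<cdot> ActArr C g (Psi C h X Y)
             \<cdot> Phi C g h (X \<boxtimes> Y)"

text \<open>An arrow \<open>a \<rightarrow> b\<close> that equals an identity forces \<open>a = b\<close>, so the two conditions below
  include \<open>g\<^sub>* (X \<otimes> Y) = g\<^sub>* X \<otimes> g\<^sub>* Y\<close> and \<open>(g h)\<^sub>* = g\<^sub>* \<circ> h\<^sub>*\<close>.\<close>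

locale strict_monoidal_G_category = monoidal_G_category G C
  for G :: "('g, 'y) monoid_scheme"
    and C :: "('g, 'o, 'm, 'z) monoidal_G_category_scheme" (structure) +
  assumes Psi_strict: "\<lbrakk>g \<in> carrier G; X \<in> Obj C; Y \<in> Obj C\<rbrakk>
          \<Longrightarrow> Psi C g X Y = Ide C (ActObj C g (X \<boxtimes> Y))"
    and Phi_strict: "\<lbrakk>g \<in> carrier G; h \<in> carrier G; X \<in> Obj C\<rbrakk>
          \<Longrightarrow> Phi C g h X = Ide C (ActObj C (g \<otimes>\<^bsub>G\<^esub> h) X)"

text \<open>\<open>g\<^sub>*\<close> as the monoidal functor \<open>(g\<^sub>*, \<psi>\<^sup>g, id)\<close>.\<close>

definition act_monoidal_functor ::
  "('g, 'o, 'm, 'z) monoidal_G_category_scheme \<Rightarrow> 'g \<Rightarrow> ('o, 'm, 'o, 'm) monoidal_functor" where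
  "act_monoidal_functor C g =
     \<lparr>FObj = ActObj C g, FArr = ActArr C g, F2 = Psi C g, F0 = Ide C (Unit C)\<rparr>"

locale monoidal_G_functor =
  C: monoidal_G_category G C + D: monoidal_G_category G D + monoidal_functor C D F
  for G :: "('g, 'x) monoid_scheme"
    and C :: "('g, 'o, 'm, 'y) monoidal_G_category_scheme"
    and D :: "('g, 'p, 'n, 'z) monoidal_G_category_scheme"
    and F :: "('o, 'm, 'p, 'n, 'w) monoidal_functor_scheme" +
  fixes \<eta> :: "'g \<Rightarrow> 'o \<Rightarrow> 'n"
  assumes eta_monoidal_nat_iso: "g \<in> carrier G \<Longrightarrow>
        monoidal_nat_iso C D
          (comp_monoidal_functor D (act_monoidal_functor D g) F)
          (comp_monoidal_functor D F (act_monoidal_functor C g)) (\<eta> g)"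
    and eta_one: "X \<in> Obj C \<Longrightarrow> \<eta> \<one>\<^bsub>G\<^esub> X = Ide D (FObj F X)"
    and eta_mult: "\<lbrakk>g \<in> carrier G; h \<in> carrier G; X \<in> Obj C\<rbrakk> \<Longrightarrow>
        FArr F (Phi C g h X) \<cdot>\<^bsub>D\<^esub> \<eta> (g \<otimes>\<^bsub>G\<^esub> h) X
        = \<eta> g (ActObj C h X) \<cdot>\<^bsub>D\<^esub> ActArr D g (\<eta> h X) \<cdot>\<^bsub>D\<^esub> Phi D g h (FObj F X)"

definition equivalent_monoidal_G_categories ::
  "('g, 'x) monoid_scheme
     \<Rightarrow> ('g, 'o, 'm, 'y) monoidal_G_category_scheme
     \<Rightarrow> ('g, 'p, 'n, 'z) monoidal_G_category_scheme \<Rightarrow> bool" where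
  "equivalent_monoidal_G_categories G C D \<longleftrightarrow>
     (\<exists>(F :: ('o, 'm, 'p, 'n) monoidal_functor) \<eta>.
        monoidal_G_functor G C D F \<eta> \<and> equivalence_of_categories C D F)"

end

theory Submission
  imports Defs
begin

text \<open>The strict model is built from formal words. An object is a list
  \<open>u = [(g\<^sub>1, X\<^sub>1), \<dots>, (g\<^sub>n, X\<^sub>n)]\<close>, read as a name for the object
  \<open>ev u = (g\<^sub>1)\<^sub>* X\<^sub>1 \<otimes> \<dots> \<otimes> (g\<^sub>n)\<^sub>* X\<^sub>n\<close> of \<open>C\<close>, and an arrow \<open>u \<rightarrow> v\<close> is an arrow
  \<open>ev u \<rightarrow> ev v\<close> of \<open>C\<close>. The tensor product concatenates words, and \<open>k\<close> acts by
  \<open>(g, X) \<mapsto> (k g, X)\<close> on every letter. On objects this action is strictly multiplicative and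
  strictly monoidal because multiplication in \<open>G\<close> is associative and because mapping over a list
  commutes with concatenation: the factors \<open>g\<close> are never evaluated before they have been
  multiplied.

  What remains is to let \<open>k\<close> act on arrows. The structure of \<open>C\<close> provides isomorphisms
  \<open>\<theta>\<^sub>k(u) : ev (k u) \<rightarrow> k\<^sub>* (ev u)\<close>, assembled from the \<open>\<phi>(k, g\<^sub>i)\<close> and from inverses of \<open>\<psi>\<^sup>k\<close>,
  and \<open>f : u \<rightarrow> v\<close> is sent to \<open>\<theta>\<^sub>k(v)\<^sup>-\<^sup>1 \<circ> k\<^sub>* f \<circ> \<theta>\<^sub>k(u)\<close>. All strictness equations on arrows
  reduce to three coherence facts about \<open>\<theta>\<close>, each proved by induction on the word:
  \<^item> \<open>\<psi>\<^sup>k \<circ> \<theta>\<^sub>k(u v) = \<theta>\<^sub>k(u) \<otimes> \<theta>\<^sub>k(v)\<close> (\<open>Psi_coh_append\<close>), so that \<open>k\<close> preserves tensor products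
    of arrows;
  \<^item> \<open>k\<^sub>*(\<theta>\<^sub>h(u)) \<circ> \<theta>\<^sub>k(h u) = \<phi>(k, h) \<circ> \<theta>\<^sub>k\<^sub>h(u)\<close> (\<open>coh_mult\<close>), so that acting by \<open>h\<close> and then by \<open>k\<close>
    is acting by \<open>k h\<close>;
  \<^item> \<open>\<theta>\<^sub>1(u) = id\<close> (\<open>coh_one\<close>), so that the unit acts as the identity.

  The equivalence sends \<open>X\<close> to the one-letter word \<open>[(1, X)]\<close>. It is fully faithful by
  construction, and essentially surjective because \<open>id : ev [(1, ev u)] \<rightarrow> ev u\<close> is an
  isomorphism \<open>[(1, ev u)] \<cong> u\<close>. All its structure maps are carried by identity
  arrows of \<open>C\<close>; the compatibility with the actions holds because \<open>\<theta>\<^sub>g\<close> computes to \<open>\<phi>\<close> on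
  one-letter words and to the inverse of \<open>\<psi>\<^sup>g\<close> on words \<open>[(1, X), (1, Y)]\<close>.\<close>

section \<open>Typing and isomorphisms\<close>

context category
begin

lemma Arr_Comp [simp]:
  assumes "f \<in> Arr C" "g \<in> Arr C" "Cod C f = Dom C g"
  shows "g \<cdot> f \<in> Arr C" "Dom C (g \<cdot> f) = Dom C f" "Cod C (g \<cdot> f) = Cod C g"
  using assms Comp_in_Hom[of f "Dom C f" "Cod C f" g "Cod C g"] by (auto simp: Hom_def)

lemma Arr_Ide [simp]:
  assumes "X \<in> Obj C"
  shows "Ide C X \<in> Arr C" "Dom C (Ide C X) = X" "Cod C (Ide C X) = X"
  using assms Ide_in_Hom by (auto simp: Hom_def)

lemma comp_assoc:
  assumes "f \<in> Arr C" "g \<in> Arr C" "h \<in> Arr C" "Cod C f = Dom C g" "Cod C g = Dom C h"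
  shows "(h \<cdot> g) \<cdot> f = h \<cdot> g \<cdot> f"
  using assms Comp_assoc[of f "Dom C f" "Cod C f" g "Cod C g" h "Cod C h"] by (auto simp: Hom_def)

lemma comp_Ide [simp]:
  assumes "f \<in> Arr C"
  shows "Dom C f = X \<Longrightarrow> f \<cdot> Ide C X = f" "Cod C f = Y \<Longrightarrow> Ide C Y \<cdot> f = f"
  using assms Comp_Ide_right[of f X "Cod C f"] Comp_Ide_left[of f "Dom C f" Y]
  by (auto simp: Hom_def)

lemmas Dom_Cod_in_Obj [simp] = Dom_in_Obj Cod_in_Obj

definition iso_arr :: "'m \<Rightarrow> bool" where
  "iso_arr f \<longleftrightarrow> f \<in> Iso C (Dom C f) (Cod C f)"

definition inv_arr :: "'m \<Rightarrow> 'm" where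
  "inv_arr f = (SOME g. g \<in> Hom C (Cod C f) (Dom C f) \<and>
     g \<cdot> f = Ide C (Dom C f) \<and> f \<cdot> g = Ide C (Cod C f))"

lemma Iso_iff: "f \<in> Iso C X Y \<longleftrightarrow> iso_arr f \<and> Dom C f = X \<and> Cod C f = Y"
  by (auto simp: iso_arr_def Iso_def Hom_def)

lemma iso_arr_in_Arr: "iso_arr f \<Longrightarrow> f \<in> Arr C"
  by (auto simp: iso_arr_def Iso_def Hom_def)

lemma inv_arr [simp]:
  assumes "iso_arr f"
  shows "inv_arr f \<in> Arr C" "Dom C (inv_arr f) = Cod C f" "Cod C (inv_arr f) = Dom C f"
    "inv_arr f \<cdot> f = Ide C (Dom C f)" "f \<cdot> inv_arr f = Ide C (Cod C f)"
proof -
  have "\<exists>g. g \<in> Hom C (Cod C f) (Dom C f) \<and>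
     g \<cdot> f = Ide C (Dom C f) \<and> f \<cdot> g = Ide C (Cod C f)"
    using assms by (auto simp: iso_arr_def Iso_def)
  from someI_ex[OF this]
  show "inv_arr f \<in> Arr C" "Dom C (inv_arr f) = Cod C f" "Cod C (inv_arr f) = Dom C f"
    "inv_arr f \<cdot> f = Ide C (Dom C f)" "f \<cdot> inv_arr f = Ide C (Cod C f)"
    unfolding inv_arr_def by (auto simp: Hom_def)
qed

lemma iso_arrI:
  assumes "f \<in> Arr C" "g \<in> Arr C" "Dom C g = Cod C f" "Cod C g = Dom C f"
    "g \<cdot> f = Ide C (Dom C f)" "f \<cdot> g = Ide C (Cod C f)"
  shows "iso_arr f"
  using assms by (auto simp: iso_arr_def Iso_def Hom_def)

lemma iso_arr_Ide [simp]: "X \<in> Obj C \<Longrightarrow> iso_arr (Ide C X)"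
  by (rule iso_arrI[of _ "Ide C X"]) auto

lemma iso_arr_inv_arr [simp]: "iso_arr f \<Longrightarrow> iso_arr (inv_arr f)"
  by (rule iso_arrI[of _ f]) (auto simp: iso_arr_in_Arr)

lemma inv_arr_cancel:
  assumes "iso_arr p" "f \<in> Arr C"
  shows "Cod C f = Dom C p \<Longrightarrow> inv_arr p \<cdot> p \<cdot> f = f"
    and "Cod C f = Cod C p \<Longrightarrow> p \<cdot> inv_arr p \<cdot> f = f"
  using assms by (simp_all add: comp_assoc[symmetric] iso_arr_in_Arr)

lemma iso_arr_Comp [simp]:
  assumes "iso_arr f" "iso_arr g" "Cod C f = Dom C g"
  shows "iso_arr (g \<cdot> f)"
proof (rule iso_arrI[of _ "inv_arr f \<cdot> inv_arr g"])
  note [simp] = assms assms(1,2)[THEN iso_arr_in_Arr]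
  show "(inv_arr f \<cdot> inv_arr g) \<cdot> g \<cdot> f = Ide C (Dom C (g \<cdot> f))"
    by (simp add: comp_assoc inv_arr_cancel)
  show "(g \<cdot> f) \<cdot> inv_arr f \<cdot> inv_arr g = Ide C (Cod C (g \<cdot> f))"
    by (simp add: comp_assoc inv_arr_cancel)
qed (use assms in \<open>auto simp: iso_arr_in_Arr\<close>)

lemma iso_arr_left_cancel:
  assumes "p \<cdot> f = p \<cdot> g"
    and "iso_arr p" "f \<in> Arr C" "g \<in> Arr C" "Cod C f = Dom C p" "Cod C g = Dom C p"
  shows "f = g"
  using assms inv_arr_cancel(1) by metis

text \<open>Used to show that components of \<open>\<phi>\<close> and \<open>\<psi>\<close> which the axioms only force to be
  idempotent are identities.\<close>

lemma idempotent_iso_arr: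
  assumes "iso_arr p" "Cod C p = Dom C p" "p \<cdot> p = p"
  shows "p = Ide C (Dom C p)"
  using assms iso_arr_left_cancel[of p p "Ide C (Dom C p)"] by (simp add: iso_arr_in_Arr)

end

context monoidal_category
begin

lemma Arr_Tensor [simp]:
  assumes "f \<in> Arr C" "k \<in> Arr C"
  shows "f \<odot> k \<in> Arr C" "Dom C (f \<odot> k) = Dom C f \<boxtimes> Dom C k"
    "Cod C (f \<odot> k) = Cod C f \<boxtimes> Cod C k"
  using assms Tensor_in_Hom[of f "Dom C f" "Cod C f" k "Dom C k" "Cod C k"]
  by (auto simp: Hom_def)

lemmas Tensor_simps [simp] =
  Tensor_in_Obj Unit_in_Obj Tensor_Ide TensorObj_Unit_right TensorObj_Unit_left
  TensorArr_Unit_right TensorArr_Unit_left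

lemma interchange:
  assumes "f \<in> Arr C" "f' \<in> Arr C" "k \<in> Arr C" "k' \<in> Arr C"
    "Cod C f = Dom C f'" "Cod C k = Dom C k'"
  shows "(f' \<odot> k') \<cdot> (f \<odot> k) = (f' \<cdot> f) \<odot> (k' \<cdot> k)"
  using assms
    Tensor_Comp[of f "Dom C f" "Cod C f" f' "Cod C f'" k "Dom C k" "Cod C k" k' "Cod C k'"]
  by (auto simp: Hom_def)

lemma iso_arr_Tensor [simp]:
  assumes "iso_arr f" "iso_arr k"
  shows "iso_arr (f \<odot> k)"
  by (rule iso_arrI[of _ "inv_arr f \<odot> inv_arr k"])
    (use assms in \<open>auto simp: iso_arr_in_Arr interchange\<close>)

end


section \<open>Naturality of the structure of a monoidal \<open>G\<close>-category\<close>

context monoidal_G_category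
begin

lemma Arr_Act [simp]:
  assumes "g \<in> carrier G" "f \<in> Arr C"
  shows "ActArr C g f \<in> Arr C" "Dom C (ActArr C g f) = ActObj C g (Dom C f)"
    "Cod C (ActArr C g f) = ActObj C g (Cod C f)"
  using assms cat_functor.FArr_in_Hom[OF Act_functor, of g f "Dom C f" "Cod C f"]
  by (auto simp: Hom_def)

lemma Act_simps [simp]:
  assumes "g \<in> carrier G"
  shows "X \<in> Obj C \<Longrightarrow> ActObj C g X \<in> Obj C" "ActObj C g (Unit C) = Unit C"
    "X \<in> Obj C \<Longrightarrow> ActArr C g (Ide C X) = Ide C (ActObj C g X)"
  using assms Act_Unit cat_functor.FObj_in_Obj[OF Act_functor]
    cat_functor.FArr_Ide[OF Act_functor] by auto

lemma Act_Comp: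
  assumes "g \<in> carrier G" "f \<in> Arr C" "f' \<in> Arr C" "Cod C f = Dom C f'"
  shows "ActArr C g (f' \<cdot> f) = ActArr C g f' \<cdot> ActArr C g f"
  using assms
    cat_functor.FArr_Comp[OF Act_functor, of g f "Dom C f" "Cod C f" f' "Cod C f'"]
  by (auto simp: Hom_def)

lemma iso_arr_Act [simp]:
  assumes "g \<in> carrier G" "iso_arr f"
  shows "iso_arr (ActArr C g f)"
  by (rule iso_arrI[of _ "ActArr C g (inv_arr f)"])
    (use assms in \<open>auto simp: iso_arr_in_Arr Act_Comp[symmetric]\<close>)

lemma Phi_simps [simp]:
  assumes "g \<in> carrier G" "h \<in> carrier G" "X \<in> Obj C"
  shows "iso_arr (Phi C g h X)" "Phi C g h X \<in> Arr C"
    "Dom C (Phi C g h X) = ActObj C (g \<otimes>\<^bsub>G\<^esub> h) X"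
    "Cod C (Phi C g h X) = ActObj C g (ActObj C h X)"
  using Phi_nat_iso[OF assms(1,2)] assms(3)
  by (auto simp: nat_iso_def Iso_iff comp_functor_def iso_arr_in_Arr)

lemma Phi_natural:
  assumes "g \<in> carrier G" "h \<in> carrier G" "f \<in> Arr C"
  shows "ActArr C g (ActArr C h f) \<cdot> Phi C g h (Dom C f)
    = Phi C g h (Cod C f) \<cdot> ActArr C (g \<otimes>\<^bsub>G\<^esub> h) f"
  using Phi_nat_iso[OF assms(1,2)] assms(3)
  by (auto simp: nat_iso_def comp_functor_def Hom_def)

lemma Psi_simps [simp]:
  assumes "g \<in> carrier G" "X \<in> Obj C" "Y \<in> Obj C"
  shows "iso_arr (Psi C g X Y)" "Psi C g X Y \<in> Arr C"
    "Dom C (Psi C g X Y) = ActObj C g (X \<boxtimes> Y)"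
    "Cod C (Psi C g X Y) = ActObj C g X \<boxtimes> ActObj C g Y"
  using Psi_nat_iso[OF assms(1)] assms(2,3)
  by (auto simp: tensor_nat_iso_def Iso_iff iso_arr_in_Arr)

lemma Psi_natural:
  assumes "g \<in> carrier G" "f \<in> Arr C" "k \<in> Arr C"
  shows "(ActArr C g f \<odot> ActArr C g k) \<cdot> Psi C g (Dom C f) (Dom C k)
    = Psi C g (Cod C f) (Cod C k) \<cdot> ActArr C g (f \<odot> k)"
proof -
  have "f \<in> Hom C (Dom C f) (Cod C f)" "k \<in> Hom C (Dom C k) (Cod C k)"
    using assms by (auto simp: Hom_def)
  then show ?thesis
    using Psi_nat_iso[OF assms(1)] assms(2,3) Dom_in_Obj Cod_in_Obj
    unfolding tensor_nat_iso_def by blast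
qed

text \<open>The compatibility of \<open>\<phi>\<close> with \<open>\<psi>\<close> at \<open>X = Y = \<one>\<close> reads \<open>p \<otimes> p = p\<close> for
  \<open>p = \<phi>(g, h)\<^sub>\<one>\<close>. On endomorphisms of the unit object the tensor product is composition, by the
  interchange law, so \<open>p\<close> is an invertible idempotent.\<close>

lemma Phi_Unit:
  assumes "g \<in> carrier G" "h \<in> carrier G"
  shows "Phi C g h (Unit C) = Ide C (Unit C)"
proof -
  let ?p = "Phi C g h (Unit C)"
  have p: "?p \<in> Arr C" "Dom C ?p = Unit C" "Cod C ?p = Unit C"
    using assms by auto
  have "?p \<odot> ?p = ?p"
    using Phi_Psi[OF assms, of "Unit C" "Unit C"] assms p by (simp add: Psi_Unit_left)
  moreover have "?p \<odot> ?p = ?p \<cdot> ?p"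
    using interchange[of "Ide C (Unit C)" ?p ?p "Ide C (Unit C)"] p by simp
  ultimately show ?thesis
    using idempotent_iso_arr[of ?p] assms p by simp
qed

text \<open>Again an invertible idempotent: the compatibility of \<open>\<phi>(1, 1) = id\<close> with \<open>\<psi>\<close> reads
  \<open>\<psi>\<^sup>1 = \<psi>\<^sup>1 \<circ> \<psi>\<^sup>1\<close>.\<close>

lemma Psi_one:
  assumes "X \<in> Obj C" "Y \<in> Obj C"
  shows "Psi C \<one>\<^bsub>G\<^esub> X Y = Ide C (X \<boxtimes> Y)"
proof -
  let ?p = "Psi C \<one>\<^bsub>G\<^esub> X Y"
  have p: "?p \<in> Arr C" "iso_arr ?p" "Dom C ?p = X \<boxtimes> Y" "Cod C ?p = X \<boxtimes> Y"
    using assms by (auto simp: ActObj_one)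
  have "?p \<cdot> ?p = ?p"
    using Phi_Psi[of "\<one>\<^bsub>G\<^esub>" "\<one>\<^bsub>G\<^esub>" X Y] assms p by (simp add: Phi_one_left ActObj_one ActArr_one)
  then show ?thesis
    using idempotent_iso_arr[of ?p] p by simp
qed


section \<open>Words and their coherence isomorphisms\<close>

primrec eval_word :: "('g \<times> 'o) list \<Rightarrow> 'o" where
  "eval_word [] = Unit C"
| "eval_word (a # u) = ActObj C (fst a) (snd a) \<boxtimes> eval_word u"

definition act_word :: "'g \<Rightarrow> ('g \<times> 'o) list \<Rightarrow> ('g \<times> 'o) list" where
  "act_word k u = map (\<lambda>(g, X). (k \<otimes>\<^bsub>G\<^esub> g, X)) u"

text \<open>The comparison \<open>\<theta>\<^sub>k(u) : ev (k u) \<rightarrow> k\<^sub>* (ev u)\<close>. The letters are split off from the left,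
  in the order in which \<open>eval_word\<close> forms the product, so each step needs \<open>\<psi>\<^sup>k\<close> only for one letter
  and one word.\<close>

primrec coh :: "'g \<Rightarrow> ('g \<times> 'o) list \<Rightarrow> 'm" where
  "coh k [] = Ide C (Unit C)"
| "coh k (a # u) = inv_arr (Psi C k (ActObj C (fst a) (snd a)) (eval_word u))
     \<cdot> (Phi C k (fst a) (snd a) \<odot> coh k u)"

definition words :: "('g \<times> 'o) list set" where
  "words = lists (carrier G \<times> Obj C)"

lemma words_simps [simp]:
  "[] \<in> words"
  "a # u \<in> words \<longleftrightarrow> fst a \<in> carrier G \<and> snd a \<in> Obj C \<and> u \<in> words"
  "u @ v \<in> words \<longleftrightarrow> u \<in> words \<and> v \<in> words"
  by (auto simp: words_def mem_Times_iff)

lemma words_induct [consumes 1, case_names Nil Cons]: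
  assumes "u \<in> words" "P []"
    "\<And>g X u. g \<in> carrier G \<Longrightarrow> X \<in> Obj C \<Longrightarrow> u \<in> words \<Longrightarrow> P u \<Longrightarrow> P ((g, X) # u)"
  shows "P u"
  using assms(1) by (induction u) (auto intro: assms(2,3))

lemma eval_word_in_Obj [simp]: "u \<in> words \<Longrightarrow> eval_word u \<in> Obj C"
  by (induction u) auto

lemma eval_word_append [simp]:
  assumes "u \<in> words" "v \<in> words"
  shows "eval_word (u @ v) = eval_word u \<boxtimes> eval_word v"
  using assms by (induction u) (simp_all add: TensorObj_assoc)

lemma act_word_simps [simp]:
  "act_word k [] = []"
  "act_word k (a # u) = (k \<otimes>\<^bsub>G\<^esub> fst a, snd a) # act_word k u"
  "act_word k (u @ v) = act_word k u @ act_word k v"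
  by (auto simp: act_word_def case_prod_unfold)

lemma act_word_in_words [simp]:
  "k \<in> carrier G \<Longrightarrow> u \<in> words \<Longrightarrow> act_word k u \<in> words"
  by (induction u) auto

lemma act_word_one [simp]: "u \<in> words \<Longrightarrow> act_word \<one>\<^bsub>G\<^esub> u = u"
  by (induction u) auto

lemma act_word_mult:
  assumes "k \<in> carrier G" "h \<in> carrier G" "u \<in> words"
  shows "act_word k (act_word h u) = act_word (k \<otimes>\<^bsub>G\<^esub> h) u"
  using assms(3) by (induction u) (use assms in \<open>auto simp: G.m_assoc\<close>)

lemma coh_simps [simp]:
  assumes "k \<in> carrier G" "u \<in> words"
  shows "iso_arr (coh k u)" "coh k u \<in> Arr C" "Dom C (coh k u) = eval_word (act_word k u)"
    "Cod C (coh k u) = ActObj C k (eval_word u)"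
proof -
  have "iso_arr (coh k u) \<and> coh k u \<in> Arr C \<and> Dom C (coh k u) = eval_word (act_word k u) \<and>
      Cod C (coh k u) = ActObj C k (eval_word u)"
    using assms(2) by (induction u) (use assms in auto)
  then show "iso_arr (coh k u)" "coh k u \<in> Arr C"
    "Dom C (coh k u) = eval_word (act_word k u)" "Cod C (coh k u) = ActObj C k (eval_word u)"
    by auto
qed

text \<open>The recursion for \<open>\<theta>\<close> without inverses, as the inductive steps below use it.\<close>

lemma Psi_coh_Cons:
  assumes "k \<in> carrier G" "g \<in> carrier G" "X \<in> Obj C" "u \<in> words"
  shows "Psi C k (ActObj C g X) (eval_word u) \<cdot> coh k ((g, X) # u) = Phi C k g X \<odot> coh k u"
  using assms by (simp add: inv_arr_cancel)

lemma coh_singleton: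
  assumes "k \<in> carrier G" "g \<in> carrier G" "X \<in> Obj C"
  shows "coh k [(g, X)] = Phi C k g X"
  using Psi_coh_Cons[OF assms, of "[]"] assms
  by (simp add: Psi_Unit_right)

text \<open>For \<open>u = (g, X) u'\<close> with \<open>A = g\<^sub>* X\<close>, \<open>B = ev u'\<close>, \<open>Z = ev v\<close>, the associativity axiom of
  \<open>\<psi>\<^sup>k\<close> trades \<open>\<psi>\<^sup>k(A \<otimes> B, Z)\<close>, about which the recursion says nothing, for \<open>\<psi>\<^sup>k(A, B \<otimes> Z)\<close>, which
  peels off the first letter, and \<open>\<psi>\<^sup>k(B, Z)\<close>, to which the induction hypothesis applies. This
  happens after composing with the isomorphism \<open>\<psi>\<^sup>k(A, B) \<otimes> id\<close>, which is cancelled at the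
  end.\<close>

lemma Psi_coh_append:
  assumes k: "k \<in> carrier G" and u: "u \<in> words" and v: "v \<in> words"
  shows "Psi C k (eval_word u) (eval_word v) \<cdot> coh k (u @ v) = coh k u \<odot> coh k v"
  using u
proof (induction u rule: words_induct)
  case Nil
  then show ?case
    using k v by (simp add: Psi_Unit_left)
next
  case (Cons g X u)
  note [simp] = k v Cons.hyps
  define A B Z where "A = ActObj C g X" and "B = eval_word u" and "Z = eval_word v"
  have obj [simp]: "A \<in> Obj C" "B \<in> Obj C" "Z \<in> Obj C"
    by (auto simp: A_def B_def Z_def)
  have ev [simp]: "eval_word ((g, X) # u) = A \<boxtimes> B" "eval_word ((g, X) # u @ v) = A \<boxtimes> B \<boxtimes> Z"
    "eval_word v = Z" "eval_word u = B" "ActObj C g X = A"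
    by (auto simp: A_def B_def Z_def)
  note [simp del] = coh.simps eval_word.simps
  have step: "Psi C k A B \<cdot> coh k ((g, X) # u) = Phi C k g X \<odot> coh k u"
    "Psi C k A (B \<boxtimes> Z) \<cdot> coh k ((g, X) # u @ v) = Phi C k g X \<odot> coh k (u @ v)"
    using Psi_coh_Cons[of k g X u] Psi_coh_Cons[of k g X "u @ v"]
    by auto
  have "(Psi C k A B \<odot> Ide C (ActObj C k Z)) \<cdot> Psi C k (A \<boxtimes> B) Z \<cdot> coh k ((g, X) # u @ v)
      = ((Psi C k A B \<odot> Ide C (ActObj C k Z)) \<cdot> Psi C k (A \<boxtimes> B) Z) \<cdot> coh k ((g, X) # u @ v)"
    by (subst comp_assoc) (simp_all add: TensorObj_assoc)
  also have "\<dots> = (Ide C (ActObj C k A) \<odot> Psi C k B Z) \<cdot> Psi C k A (B \<boxtimes> Z) \<cdot> coh k ((g, X) # u @ v)"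
    by (subst Psi_assoc) (simp_all add: comp_assoc)
  also have "\<dots> = (Ide C (ActObj C k A) \<cdot> Phi C k g X) \<odot> (Psi C k B Z \<cdot> coh k (u @ v))"
    by (subst step) (simp add: interchange)
  also have "\<dots> = Phi C k g X \<odot> (coh k u \<odot> coh k v)"
    using Cons.IH by simp
  also have "\<dots> = (Psi C k A B \<cdot> coh k ((g, X) # u)) \<odot> coh k v"
    by (simp add: step TensorArr_assoc)
  also have "\<dots> = (Psi C k A B \<odot> Ide C (ActObj C k Z)) \<cdot> (coh k ((g, X) # u) \<odot> coh k v)"
    by (simp add: interchange)
  finally have "Psi C k (A \<boxtimes> B) Z \<cdot> coh k ((g, X) # u @ v) = coh k ((g, X) # u) \<odot> coh k v"
    by (rule iso_arr_left_cancel)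
      (simp_all add: TensorObj_assoc)
  then show ?case
    by simp
qed

text \<open>The cocycle identity for \<open>\<phi>\<close> settles one letter, and the compatibility of \<open>\<phi>\<close> with \<open>\<psi>\<close>
  passes from the letters to the word. The inductive step compares both sides after composing
  with the isomorphism \<open>?P\<close> from \<open>k\<^sub>* (h\<^sub>* (A \<otimes> B))\<close> to \<open>k\<^sub>* (h\<^sub>* A) \<otimes> k\<^sub>* (h\<^sub>* B)\<close>; there both sides
  split as a tensor product of a letter part and a part given by the induction hypothesis. The
  empty word is the reason for \<open>Phi_Unit\<close>.\<close>

lemma coh_mult:
  assumes k: "k \<in> carrier G" and h: "h \<in> carrier G" and u: "u \<in> words"
  shows "ActArr C k (coh h u) \<cdot> coh k (act_word h u)
    = Phi C k h (eval_word u) \<cdot> coh (k \<otimes>\<^bsub>G\<^esub> h) u"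
  using u
proof (induction u rule: words_induct)
  case Nil
  then show ?case
    using k h by (simp add: Phi_Unit)
next
  case (Cons g X u)
  note [simp] = k h Cons.hyps
  define A B where "A = ActObj C g X" and "B = eval_word u"
  have obj [simp]: "A \<in> Obj C" "B \<in> Obj C"
    by (auto simp: A_def B_def)
  have ev [simp]: "eval_word ((g, X) # u) = A \<boxtimes> B" "eval_word u = B" "ActObj C g X = A"
    by (auto simp: A_def B_def)
  have evh [simp]: "eval_word (act_word k (act_word h ((g, X) # u))) =
      ActObj C (k \<otimes>\<^bsub>G\<^esub> h \<otimes>\<^bsub>G\<^esub> g) X \<boxtimes> eval_word (act_word (k \<otimes>\<^bsub>G\<^esub> h) u)"
    "eval_word (act_word (k \<otimes>\<^bsub>G\<^esub> h) ((g, X) # u)) =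
      ActObj C (k \<otimes>\<^bsub>G\<^esub> h \<otimes>\<^bsub>G\<^esub> g) X \<boxtimes> eval_word (act_word (k \<otimes>\<^bsub>G\<^esub> h) u)"
    by (auto simp: act_word_mult G.m_assoc)
  have evh' [simp]: "eval_word (act_word h ((g, X) # u)) =
      ActObj C (h \<otimes>\<^bsub>G\<^esub> g) X \<boxtimes> eval_word (act_word h u)"
    by auto
  note [simp del] = coh.simps eval_word.simps act_word_simps
  let ?c = "coh k (act_word h ((g, X) # u))"
  have step: "Psi C h A B \<cdot> coh h ((g, X) # u) = Phi C h g X \<odot> coh h u"
    "Psi C (k \<otimes>\<^bsub>G\<^esub> h) A B \<cdot> coh (k \<otimes>\<^bsub>G\<^esub> h) ((g, X) # u)
       = Phi C (k \<otimes>\<^bsub>G\<^esub> h) g X \<odot> coh (k \<otimes>\<^bsub>G\<^esub> h) u"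
    "Psi C k (ActObj C (h \<otimes>\<^bsub>G\<^esub> g) X) (eval_word (act_word h u)) \<cdot> ?c
       = Phi C k (h \<otimes>\<^bsub>G\<^esub> g) X \<odot> coh k (act_word h u)"
    using Psi_coh_Cons[of h g X u] Psi_coh_Cons[of "k \<otimes>\<^bsub>G\<^esub> h" g X u]
      Psi_coh_Cons[of k "h \<otimes>\<^bsub>G\<^esub> g" X "act_word h u"]
    by (auto simp: act_word_simps)
  let ?P = "Psi C k (ActObj C h A) (ActObj C h B) \<cdot> ActArr C k (Psi C h A B)"
  have "?P \<cdot> ActArr C k (coh h ((g, X) # u)) \<cdot> ?c
      = Psi C k (ActObj C h A) (ActObj C h B)
        \<cdot> ActArr C k (Psi C h A B \<cdot> coh h ((g, X) # u)) \<cdot> ?c"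
    by (simp add: comp_assoc Act_Comp)
  also have "\<dots> = (Psi C k (ActObj C h A) (ActObj C h B)
        \<cdot> ActArr C k (Phi C h g X \<odot> coh h u)) \<cdot> ?c"
    by (simp add: step comp_assoc)
  also have "\<dots> = ((ActArr C k (Phi C h g X) \<odot> ActArr C k (coh h u))
        \<cdot> Psi C k (ActObj C (h \<otimes>\<^bsub>G\<^esub> g) X) (eval_word (act_word h u))) \<cdot> ?c"
    using Psi_natural[of k "Phi C h g X" "coh h u"] by simp
  also have "\<dots> = (ActArr C k (Phi C h g X) \<odot> ActArr C k (coh h u))
        \<cdot> (Phi C k (h \<otimes>\<^bsub>G\<^esub> g) X \<odot> coh k (act_word h u))"
    by (simp add: step comp_assoc)
  also have "\<dots> = (ActArr C k (Phi C h g X) \<cdot> Phi C k (h \<otimes>\<^bsub>G\<^esub> g) X)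
        \<odot> (ActArr C k (coh h u) \<cdot> coh k (act_word h u))"
    by (simp add: interchange)
  also have "\<dots> = (Phi C k h A \<cdot> Phi C (k \<otimes>\<^bsub>G\<^esub> h) g X) \<odot> (Phi C k h B \<cdot> coh (k \<otimes>\<^bsub>G\<^esub> h) u)"
    using Cons.IH Phi_assoc[of k h g X] by simp
  also have "\<dots> = (Phi C k h A \<odot> Phi C k h B)
        \<cdot> Psi C (k \<otimes>\<^bsub>G\<^esub> h) A B \<cdot> coh (k \<otimes>\<^bsub>G\<^esub> h) ((g, X) # u)"
    by (simp add: step interchange)
  also have "\<dots> = ((Phi C k h A \<odot> Phi C k h B) \<cdot> Psi C (k \<otimes>\<^bsub>G\<^esub> h) A B)
        \<cdot> coh (k \<otimes>\<^bsub>G\<^esub> h) ((g, X) # u)"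
    by (simp add: comp_assoc)
  also have "\<dots> = ?P \<cdot> Phi C k h (A \<boxtimes> B) \<cdot> coh (k \<otimes>\<^bsub>G\<^esub> h) ((g, X) # u)"
    by (simp add: Phi_Psi comp_assoc)
  finally have "ActArr C k (coh h ((g, X) # u)) \<cdot> ?c
      = Phi C k h (A \<boxtimes> B) \<cdot> coh (k \<otimes>\<^bsub>G\<^esub> h) ((g, X) # u)"
    by (rule iso_arr_left_cancel) (simp_all add: G.m_assoc)
  then show ?case
    by simp
qed

lemma coh_one:
  assumes "u \<in> words"
  shows "coh \<one>\<^bsub>G\<^esub> u = Ide C (eval_word u)"
  using assms
proof (induction u rule: words_induct)
  case (Cons g X u)
  then show ?case
    using Psi_coh_Cons[of "\<one>\<^bsub>G\<^esub>" g X u] coh_simps[of "\<one>\<^bsub>G\<^esub>" "(g, X) # u"]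
    by (simp add: Psi_one Phi_one_left ActObj_one del: coh.simps coh_simps)
qed simp


section \<open>The strictification\<close>

text \<open>The action of \<open>k\<close> on an arrow \<open>f : u \<rightarrow> v\<close>. The words are explicit arguments, because \<open>f\<close>,
  as an arrow of \<open>C\<close>, only remembers their values.\<close>

definition act_hom :: "'g \<Rightarrow> ('g \<times> 'o) list \<Rightarrow> 'm \<Rightarrow> ('g \<times> 'o) list \<Rightarrow> 'm" where
  "act_hom k u f v = inv_arr (coh k v) \<cdot> ActArr C k f \<cdot> coh k u"

lemma act_hom_simps [simp]:
  assumes "k \<in> carrier G" "u \<in> words" "v \<in> words" "f \<in> Arr C" "Dom C f = eval_word u"
    "Cod C f = eval_word v"
  shows "act_hom k u f v \<in> Arr C" "Dom C (act_hom k u f v) = eval_word (act_word k u)"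
    "Cod C (act_hom k u f v) = eval_word (act_word k v)"
  using assms by (auto simp: act_hom_def)

lemma act_hom_natural:
  assumes "k \<in> carrier G" "u \<in> words" "v \<in> words" "f \<in> Arr C" "Dom C f = eval_word u"
    "Cod C f = eval_word v"
  shows "coh k v \<cdot> act_hom k u f v = ActArr C k f \<cdot> coh k u"
  using assms by (simp add: act_hom_def inv_arr_cancel)

text \<open>As \<open>\<theta>\<^sub>k(v)\<close> is invertible, naturality of \<open>\<theta>\<^sub>k\<close> determines the action on arrows. The laws of
  the action below are all instances of this uniqueness.\<close>

lemma act_hom_eqI:
  assumes "k \<in> carrier G" "u \<in> words" "v \<in> words" "f \<in> Arr C" "Dom C f = eval_word u"
    "Cod C f = eval_word v"
    and "x \<in> Arr C" "Cod C x = eval_word (act_word k v)"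
    and "coh k v \<cdot> x = ActArr C k f \<cdot> coh k u"
  shows "act_hom k u f v = x"
  by (rule iso_arr_left_cancel[of "coh k v"]) (use assms in \<open>simp_all add: act_hom_natural\<close>)

lemma act_hom_Ide:
  assumes "k \<in> carrier G" "u \<in> words"
  shows "act_hom k u (Ide C (eval_word u)) u = Ide C (eval_word (act_word k u))"
  by (rule act_hom_eqI) (use assms in simp_all)

lemma act_hom_Comp:
  assumes "k \<in> carrier G" "u \<in> words" "v \<in> words" "w \<in> words"
    "f \<in> Arr C" "Dom C f = eval_word u" "Cod C f = eval_word v"
    "g \<in> Arr C" "Dom C g = eval_word v" "Cod C g = eval_word w"
  shows "act_hom k u (g \<cdot> f) w = act_hom k v g w \<cdot> act_hom k u f v"
proof (rule act_hom_eqI)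
  note [simp] = assms
  have "coh k w \<cdot> act_hom k v g w \<cdot> act_hom k u f v
      = (coh k w \<cdot> act_hom k v g w) \<cdot> act_hom k u f v"
    by (simp add: comp_assoc)
  also have "\<dots> = ActArr C k g \<cdot> coh k v \<cdot> act_hom k u f v"
    by (simp add: act_hom_natural comp_assoc)
  also have "\<dots> = ActArr C k (g \<cdot> f) \<cdot> coh k u"
    by (simp add: act_hom_natural comp_assoc Act_Comp)
  finally show "coh k w \<cdot> act_hom k v g w \<cdot> act_hom k u f v = ActArr C k (g \<cdot> f) \<cdot> coh k u" .
qed (use assms in simp_all)

lemma act_hom_Tensor:
  assumes "k \<in> carrier G" "u \<in> words" "v \<in> words" "u' \<in> words" "v' \<in> words"
    "f \<in> Arr C" "Dom C f = eval_word u" "Cod C f = eval_word v"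
    "g \<in> Arr C" "Dom C g = eval_word u'" "Cod C g = eval_word v'"
  shows "act_hom k (u @ u') (f \<odot> g) (v @ v') = act_hom k u f v \<odot> act_hom k u' g v'"
proof (rule act_hom_eqI)
  note [simp] = assms
  let ?x = "act_hom k u f v \<odot> act_hom k u' g v'"
  let ?P = "Psi C k (eval_word v) (eval_word v')"
  have [simp]: "u @ u' \<in> words" "v @ v' \<in> words"
    by auto
  have "?P \<cdot> coh k (v @ v') \<cdot> ?x = (?P \<cdot> coh k (v @ v')) \<cdot> ?x"
    by (simp add: comp_assoc)
  also have "\<dots> = (ActArr C k f \<cdot> coh k u) \<odot> (ActArr C k g \<cdot> coh k u')"
    by (simp add: Psi_coh_append interchange act_hom_natural)
  also have "\<dots> = (ActArr C k f \<odot> ActArr C k g) \<cdot>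
      Psi C k (eval_word u) (eval_word u') \<cdot> coh k (u @ u')"
    by (simp add: Psi_coh_append interchange)
  also have "\<dots> = ((ActArr C k f \<odot> ActArr C k g) \<cdot>
      Psi C k (eval_word u) (eval_word u')) \<cdot> coh k (u @ u')"
    by (simp add: comp_assoc)
  also have "\<dots> = ?P \<cdot> ActArr C k (f \<odot> g) \<cdot> coh k (u @ u')"
    using Psi_natural[of k f g] by (simp add: comp_assoc)
  finally show "coh k (v @ v') \<cdot> ?x = ActArr C k (f \<odot> g) \<cdot> coh k (u @ u')"
    by (rule iso_arr_left_cancel) simp_all
qed (use assms in auto)

lemma act_hom_mult:
  assumes "k \<in> carrier G" "h \<in> carrier G" "u \<in> words" "v \<in> words"
    "f \<in> Arr C" "Dom C f = eval_word u" "Cod C f = eval_word v"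
  shows "act_hom (k \<otimes>\<^bsub>G\<^esub> h) u f v
    = act_hom k (act_word h u) (act_hom h u f v) (act_word h v)"
proof (rule act_hom_eqI)
  note [simp] = assms act_word_mult
  let ?x = "act_hom k (act_word h u) (act_hom h u f v) (act_word h v)"
  let ?P = "Phi C k h (eval_word v)"
  have "?P \<cdot> coh (k \<otimes>\<^bsub>G\<^esub> h) v \<cdot> ?x = (?P \<cdot> coh (k \<otimes>\<^bsub>G\<^esub> h) v) \<cdot> ?x"
    by (simp add: comp_assoc)
  also have "\<dots> = ActArr C k (coh h v) \<cdot> coh k (act_word h v) \<cdot> ?x"
    by (simp add: coh_mult[symmetric] comp_assoc)
  also have "\<dots> = ActArr C k (coh h v) \<cdot> ActArr C k (act_hom h u f v) \<cdot> coh k (act_word h u)"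
    by (simp add: act_hom_natural)
  also have "\<dots> = ActArr C k (coh h v \<cdot> act_hom h u f v) \<cdot> coh k (act_word h u)"
    by (simp add: Act_Comp comp_assoc)
  also have "\<dots> = ActArr C k (ActArr C h f) \<cdot> ActArr C k (coh h u) \<cdot> coh k (act_word h u)"
    by (simp add: act_hom_natural Act_Comp comp_assoc)
  also have "\<dots> = (ActArr C k (ActArr C h f) \<cdot> Phi C k h (eval_word u)) \<cdot> coh (k \<otimes>\<^bsub>G\<^esub> h) u"
    by (simp add: coh_mult comp_assoc)
  also have "\<dots> = ?P \<cdot> ActArr C (k \<otimes>\<^bsub>G\<^esub> h) f \<cdot> coh (k \<otimes>\<^bsub>G\<^esub> h) u"
    using Phi_natural[of k h f] by (simp add: comp_assoc)
  finally show "coh (k \<otimes>\<^bsub>G\<^esub> h) v \<cdot> ?x = ActArr C (k \<otimes>\<^bsub>G\<^esub> h) f \<cdot> coh (k \<otimes>\<^bsub>G\<^esub> h) u"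
    by (rule iso_arr_left_cancel) simp_all
qed (use assms in \<open>auto simp: act_word_mult\<close>)

lemma act_hom_one:
  assumes "u \<in> words" "v \<in> words" "f \<in> Arr C" "Dom C f = eval_word u" "Cod C f = eval_word v"
  shows "act_hom \<one>\<^bsub>G\<^esub> u f v = f"
  by (rule act_hom_eqI) (use assms in \<open>simp_all add: coh_one ActArr_one\<close>)


type_synonym (in -) ('g, 'o, 'm) word_arr = "('g \<times> 'o) list \<times> 'm \<times> ('g \<times> 'o) list"

text \<open>The arrows carry their source and target words, since different words may have the same
  value. The constraints \<open>\<phi>\<close> and \<open>\<psi>\<close> are the identities, as strictness demands.\<close>

definition strictification :: "('g, ('g \<times> 'o) list, ('g, 'o, 'm) word_arr) monoidal_G_category" where
  "strictification =
     \<lparr>Obj = words,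
      Arr = {(u, f, v). u \<in> words \<and> v \<in> words \<and> f \<in> Hom C (eval_word u) (eval_word v)},
      Dom = (\<lambda>(u, f, v). u),
      Cod = (\<lambda>(u, f, v). v),
      Ide = (\<lambda>u. (u, Ide C (eval_word u), u)),
      Comp = (\<lambda>(v', f', w) (u, f, v). (u, f' \<cdot> f, w)),
      TensorObj = (@),
      TensorArr = (\<lambda>(u, f, v) (u', f', v'). (u @ u', f \<odot> f', v @ v')),
      Unit = [],
      Act = (\<lambda>k. \<lparr>FObj = act_word k,
                   FArr = (\<lambda>(u, f, v). (act_word k u, act_hom k u f v, act_word k v))\<rparr>),
      Phi = (\<lambda>k h u. let w = act_word (k \<otimes>\<^bsub>G\<^esub> h) u in (w, Ide C (eval_word w), w)),
      Psi = (\<lambda>k u v. let w = act_word k (u @ v) in (w, Ide C (eval_word w), w))\<rparr>"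

abbreviation D where "D \<equiv> strictification"

lemma strictification_simps [simp]:
  "Obj D = words"
  "Ide D u = (u, Ide C (eval_word u), u)"
  "Comp D (v', f', w) (u, f, v) = (u, f' \<cdot> f, w)"
  "TensorObj D u v = u @ v"
  "TensorArr D (u, f, v) (u', l, v') = (u @ u', f \<odot> l, v @ v')"
  "Unit D = []"
  "ActObj D k u = act_word k u"
  "ActArr D k (u, f, v) = (act_word k u, act_hom k u f v, act_word k v)"
  "Phi D k h u = Ide D (act_word (k \<otimes>\<^bsub>G\<^esub> h) u)"
  "Psi D k u v = Ide D (act_word k (u @ v))"
  by (simp_all add: strictification_def Let_def)

lemma Arr_strictification:
  "a \<in> Arr D \<longleftrightarrow> (\<exists>u f v. a = (u, f, v) \<and> u \<in> words \<and> v \<in> words \<and>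
     f \<in> Arr C \<and> Dom C f = eval_word u \<and> Cod C f = eval_word v)"
  by (auto simp: strictification_def Hom_def)

lemma Hom_strictification:
  "a \<in> Hom D u v \<longleftrightarrow> (\<exists>f. a = (u, f, v) \<and> u \<in> words \<and> v \<in> words \<and>
     f \<in> Arr C \<and> Dom C f = eval_word u \<and> Cod C f = eval_word v)"
  by (auto simp: strictification_def Hom_def)

lemma Iso_strictificationI:
  assumes "f \<in> Iso C (eval_word u) (eval_word v)" "u \<in> words" "v \<in> words"
  shows "(u, f, v) \<in> Iso D u v"
proof -
  have f: "iso_arr f" "f \<in> Arr C" "Dom C f = eval_word u" "Cod C f = eval_word v"
    using assms(1) by (auto simp: Iso_iff iso_arr_in_Arr)
  show ?thesis
    unfolding Iso_def
    using f assms(2,3) by (auto simp: Hom_strictification intro!: bexI[of _ "(v, inv_arr f, u)"])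
qed

lemma category_strictification: "category D"
  by unfold_locales
    (auto simp: Hom_strictification Arr_strictification comp_assoc,
     auto simp: strictification_def)

lemma monoidal_category_strictification: "monoidal_category D"
proof -
  interpret D: category D
    by (rule category_strictification)
  show ?thesis
    by unfold_locales
      (auto simp: Hom_strictification Arr_strictification interchange TensorArr_assoc)
qed

lemma strict_monoidal_G_category_strictification: "strict_monoidal_G_category G D"
proof -
  interpret D: monoidal_category D
    by (rule monoidal_category_strictification)
  have Ide_Iso: "(u, Ide C (eval_word u), u) \<in> Iso D u u" if "u \<in> words" for u
    using that by (intro Iso_strictificationI) (auto simp: Iso_iff)
  have act_Ide: "act_hom g (u @ v) (Ide C (eval_word u \<boxtimes> eval_word v)) (u @ v)
      = Ide C (eval_word (act_word g u) \<boxtimes> eval_word (act_word g v))"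
    if "g \<in> carrier G" "u \<in> words" "v \<in> words" for g u v
    using that act_hom_Ide[of g "u @ v"] by simp
  show ?thesis
  proof unfold_locales
    fix g h assume gh: "g \<in> carrier G" "h \<in> carrier G"
    show "nat_iso D D (Act D (g \<otimes>\<^bsub>G\<^esub> h)) (comp_functor (Act D g) (Act D h)) (Phi D g h)"
      using gh Ide_Iso by (auto simp: nat_iso_def comp_functor_def Hom_strictification
        act_word_mult act_hom_mult)
  next
    fix g assume g: "g \<in> carrier G"
    show "tensor_nat_iso D D (Act D g) (Psi D g)"
      using g Ide_Iso[of "act_word g u @ act_word g v" for u v]
      by (auto simp: tensor_nat_iso_def Hom_strictification act_hom_Tensor)
  qed (auto simp: Hom_strictification Arr_strictification act_hom_one act_word_mult act_hom_Ide
     act_Ide act_hom_Comp TensorObj_assoc G.m_assoc)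
qed


section \<open>The equivalence\<close>

definition embed :: "('o, 'm, ('g \<times> 'o) list, ('g, 'o, 'm) word_arr) monoidal_functor" where
  "embed =
     \<lparr>FObj = (\<lambda>X. [(\<one>\<^bsub>G\<^esub>, X)]),
      FArr = (\<lambda>f. ([(\<one>\<^bsub>G\<^esub>, Dom C f)], f, [(\<one>\<^bsub>G\<^esub>, Cod C f)])),
      F2 = (\<lambda>X Y. ([(\<one>\<^bsub>G\<^esub>, X \<boxtimes> Y)], Ide C (X \<boxtimes> Y), [(\<one>\<^bsub>G\<^esub>, X), (\<one>\<^bsub>G\<^esub>, Y)])),
      F0 = ([(\<one>\<^bsub>G\<^esub>, Unit C)], Ide C (Unit C), [])\<rparr>"

definition eval_functor :: "(('g \<times> 'o) list, ('g, 'o, 'm) word_arr, 'o, 'm) cat_functor" where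
  "eval_functor = \<lparr>FObj = eval_word, FArr = (\<lambda>(u, f, v). f)\<rparr>"

lemma embed_simps [simp]:
  "FObj embed X = [(\<one>\<^bsub>G\<^esub>, X)]"
  "FArr embed f = ([(\<one>\<^bsub>G\<^esub>, Dom C f)], f, [(\<one>\<^bsub>G\<^esub>, Cod C f)])"
  "F2 embed X Y = ([(\<one>\<^bsub>G\<^esub>, X \<boxtimes> Y)], Ide C (X \<boxtimes> Y), [(\<one>\<^bsub>G\<^esub>, X), (\<one>\<^bsub>G\<^esub>, Y)])"
  "F0 embed = ([(\<one>\<^bsub>G\<^esub>, Unit C)], Ide C (Unit C), [])"
  by (simp_all add: embed_def)

lemma cat_functor_embed: "cat_functor C D embed"
proof -
  interpret D: category D
    by (rule category_strictification)
  show ?thesis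
    by unfold_locales (auto simp: Hom_strictification Hom_def[of C] ActObj_one)
qed

lemma monoidal_functor_embed: "monoidal_functor C D embed"
proof -
  interpret D: monoidal_category D
    by (rule monoidal_category_strictification)
  interpret E: cat_functor C D embed
    by (rule cat_functor_embed)
  show ?thesis
  proof unfold_locales
    show "tensor_nat_iso C D embed (F2 embed)"
      by (auto simp: tensor_nat_iso_def Hom_def[of C] ActObj_one Iso_iff intro!: Iso_strictificationI)
    show "F0 embed \<in> Iso D (FObj embed (Unit C)) (Unit D)"
      by (auto simp: Iso_iff intro!: Iso_strictificationI)
  qed (auto simp: ActObj_one TensorObj_assoc)
qed

lemma equivalence_embed: "equivalence_of_categories C D embed"
proof -
  interpret D: category D
    by (rule category_strictification)
  have "cat_functor D C eval_functor"
    by unfold_locales (auto simp: Hom_strictification eval_functor_def Hom_def[of C])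
  moreover have "nat_iso C C (comp_functor eval_functor embed) id_functor (Ide C)"
    by (auto simp: nat_iso_def comp_functor_def id_functor_def eval_functor_def Iso_iff ActObj_one
      Hom_def[of C])
  moreover have "nat_iso D D (comp_functor embed eval_functor) id_functor
      (\<lambda>u. ([(\<one>\<^bsub>G\<^esub>, eval_word u)], Ide C (eval_word u), u))"
    by (auto simp: nat_iso_def comp_functor_def id_functor_def eval_functor_def Iso_iff ActObj_one
      Hom_strictification intro!: Iso_strictificationI)
  ultimately show ?thesis
    using cat_functor_embed unfolding equivalence_of_categories_def by blast
qed

text \<open>The words \<open>g [(1, X)] = [(g, X)]\<close> and \<open>[(1, g\<^sub>* X)]\<close> have the same value \<open>g\<^sub>* X\<close>.\<close>

definition embed_eta :: "'g \<Rightarrow> 'o \<Rightarrow> ('g, 'o, 'm) word_arr" where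
  "embed_eta g X = ([(g, X)], Ide C (ActObj C g X), [(\<one>\<^bsub>G\<^esub>, ActObj C g X)])"

lemma act_hom_embed:
  assumes "g \<in> carrier G" "f \<in> Arr C"
  shows "act_hom g [(\<one>\<^bsub>G\<^esub>, Dom C f)] f [(\<one>\<^bsub>G\<^esub>, Cod C f)] = ActArr C g f"
  by (rule act_hom_eqI)
    (use assms in \<open>simp_all add: coh_singleton Phi_one_right ActObj_one del: coh.simps\<close>)

text \<open>Acting on the structure map of the embedding, which is an identity in \<open>C\<close>, produces
  \<open>\<psi>\<^sup>g\<close>, since \<open>Psi_coh_append\<close> identifies \<open>\<theta>\<^sub>g([(1, X), (1, Y)])\<close> with its inverse. This is
  what makes \<open>embed_eta\<close> monoidal.\<close>

lemma act_hom_F2_embed: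
  assumes "g \<in> carrier G" "X \<in> Obj C" "Y \<in> Obj C"
  shows "act_hom g [(\<one>\<^bsub>G\<^esub>, X \<boxtimes> Y)] (Ide C (X \<boxtimes> Y)) [(\<one>\<^bsub>G\<^esub>, X), (\<one>\<^bsub>G\<^esub>, Y)] = Psi C g X Y"
proof (rule act_hom_eqI)
  have "Psi C g X Y \<cdot> coh g [(\<one>\<^bsub>G\<^esub>, X), (\<one>\<^bsub>G\<^esub>, Y)] = Ide C (ActObj C g X \<boxtimes> ActObj C g Y)"
    using Psi_coh_append[of g "[(\<one>\<^bsub>G\<^esub>, X)]" "[(\<one>\<^bsub>G\<^esub>, Y)]"] assms
    by (simp add: coh_singleton Phi_one_right ActObj_one del: coh.simps)
  then have "Psi C g X Y \<cdot> coh g [(\<one>\<^bsub>G\<^esub>, X), (\<one>\<^bsub>G\<^esub>, Y)] \<cdot> Psi C g X Y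
      = Psi C g X Y \<cdot> Ide C (ActObj C g (X \<boxtimes> Y))"
    using assms by (simp add: comp_assoc[symmetric] ActObj_one del: coh.simps)
  then have "coh g [(\<one>\<^bsub>G\<^esub>, X), (\<one>\<^bsub>G\<^esub>, Y)] \<cdot> Psi C g X Y = Ide C (ActObj C g (X \<boxtimes> Y))"
    by (rule iso_arr_left_cancel) (use assms in \<open>simp_all add: ActObj_one del: coh.simps\<close>)
  then show "coh g [(\<one>\<^bsub>G\<^esub>, X), (\<one>\<^bsub>G\<^esub>, Y)] \<cdot> Psi C g X Y
      = ActArr C g (Ide C (X \<boxtimes> Y)) \<cdot> coh g [(\<one>\<^bsub>G\<^esub>, X \<boxtimes> Y)]"
    using assms by (simp add: coh_singleton Phi_one_right del: coh.simps)
qed (use assms in \<open>simp_all add: ActObj_one\<close>)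

lemma act_hom_F0_embed:
  assumes "g \<in> carrier G"
  shows "act_hom g [(\<one>\<^bsub>G\<^esub>, Unit C)] (Ide C (Unit C)) [] = Ide C (Unit C)"
  by (rule act_hom_eqI) (use assms in \<open>simp_all add: coh_singleton Phi_one_right del: coh.simps(2)\<close>)

text \<open>The source of \<open>\<phi>\<close> in the compatibility of \<open>embed_eta\<close> with products in \<open>G\<close>: here
  \<open>\<theta>\<^sub>g([(h, X)]) = \<phi>(g, h)\<^sub>X\<close>, while \<open>\<theta>\<^sub>g([(1, h\<^sub>* X)])\<close> is an identity.\<close>

lemma act_hom_embed_eta:
  assumes "g \<in> carrier G" "h \<in> carrier G" "X \<in> Obj C"
  shows "act_hom g [(h, X)] (Ide C (ActObj C h X)) [(\<one>\<^bsub>G\<^esub>, ActObj C h X)] = Phi C g h X"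
  by (rule act_hom_eqI)
    (use assms in \<open>simp_all add: coh_singleton Phi_one_right ActObj_one del: coh.simps\<close>)

lemma monoidal_G_functor_embed: "monoidal_G_functor G C D embed embed_eta"
proof -
  interpret D: strict_monoidal_G_category G D
    by (rule strict_monoidal_G_category_strictification)
  interpret E: monoidal_functor C D embed
    by (rule monoidal_functor_embed)
  note [simp] = comp_monoidal_functor_def act_monoidal_functor_def embed_eta_def ActObj_one
  show ?thesis
  proof unfold_locales
    fix g assume g: "g \<in> carrier G"
    show "monoidal_nat_iso C D (comp_monoidal_functor D (act_monoidal_functor D g) embed)
      (comp_monoidal_functor D embed (act_monoidal_functor C g)) (embed_eta g)"
      unfolding monoidal_nat_iso_def nat_iso_def
      using g by (auto simp: Hom_def[of C] act_hom_embed act_hom_F2_embed act_hom_F0_embed Iso_iff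
        intro!: Iso_strictificationI)
  next
    fix g h X assume "g \<in> carrier G" "h \<in> carrier G" "X \<in> Obj C"
    then show "FArr embed (Phi C g h X) \<cdot>\<^bsub>D\<^esub> embed_eta (g \<otimes>\<^bsub>G\<^esub> h) X
        = embed_eta g (ActObj C h X) \<cdot>\<^bsub>D\<^esub> ActArr D g (embed_eta h X) \<cdot>\<^bsub>D\<^esub> Phi D g h (FObj embed X)"
      by (simp add: act_hom_embed_eta)
  qed auto
qed

end

theorem theorem1p1:
  fixes G :: "('g, 'y) monoid_scheme"
    and C :: "('g, 'o, 'm) monoidal_G_category"
  assumes "group G"
    and "monoidal_G_category G C"
  shows "\<exists>D :: ('g, ('g \<times> 'o) list, ('g \<times> 'o) list \<times> 'm \<times> ('g \<times> 'o) list) monoidal_G_category.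
           strict_monoidal_G_category G D \<and> equivalent_monoidal_G_categories G C D"
proof -
  interpret monoidal_G_category G C
    by (rule assms(2))
  show ?thesis
    unfolding equivalent_monoidal_G_categories_def
    using strict_monoidal_G_category_strictification monoidal_G_functor_embed equivalence_embed
    by blast
qed

end
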